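(* Let $G$ be a connected bipartite graph. If $G$ is $\{-1,0,1\}$-diagonalizable, then $G$ is regular.
   Context: All graphs are finite, simple, undirected, unweighted, and loopless. For a graph $G$, $L(G) = D(G) - A(G)$ is its Laplacian matrix. $G$ is $\{-1,0,1\}$-diagonalizable if there is a basis of eigenvectors of $L(G)$ whose entries all belong to $\{-1,0,1\}$; equivalently, there is an invertible matrix $P$ with all entries in $\{-1,0,1\}$ such that $P^{-1}L(G)P$ is diagonal. *)

theory Defs
  imports "HOL-Analysis.Analysis" "Graph_Theory.Graph_Theory"
begin

text \<open>
  A finite simple graph is a \<open>pair_graph\<close>: a finite digraph without loops or parallel arcs whose arc
  set is symmetric, an edge being a pair of opposite arcs. The degree of a vertex is therefore its
  out-degree. The matrices are indexed by the vertex type, so they belong to the graph only if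
  \<open>pverts G = UNIV\<close>.
\<close>

definition adjacency_matrix :: "'v::finite pair_pre_digraph \<Rightarrow> real^'v^'v" where
  "adjacency_matrix G = (\<chi> u v. if (u, v) \<in> parcs G then 1 else 0)"

definition degree_matrix :: "'v::finite pair_pre_digraph \<Rightarrow> real^'v^'v" where
  "degree_matrix G = (\<chi> u v. if u = v then real (out_degree (with_proj G) u) else 0)"

definition laplacian_matrix :: "'v::finite pair_pre_digraph \<Rightarrow> real^'v^'v" where
  "laplacian_matrix G = degree_matrix G - adjacency_matrix G"

definition eigenvector :: "real^'n^'n \<Rightarrow> real^'n \<Rightarrow> bool" where
  "eigenvector A x \<longleftrightarrow> x \<noteq> 0 \<and> (\<exists>c. A *v x = c *s x)"

definition sign_diagonalizable :: "'v::finite pair_pre_digraph \<Rightarrow> bool" where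
  "sign_diagonalizable G \<longleftrightarrow>
    (\<exists>B. independent B \<and> span B = UNIV \<and>
      (\<forall>x\<in>B. eigenvector (laplacian_matrix G) x \<and> (\<forall>v. x $ v \<in> {-1, 0, 1})))"

definition bipartite :: "'v pair_pre_digraph \<Rightarrow> bool" where
  "bipartite G \<longleftrightarrow>
    (\<exists>U W. U \<union> W = pverts G \<and> U \<inter> W = {} \<and> parcs G \<subseteq> (U \<times> W) \<union> (W \<times> U))"

definition regular :: "'v pair_pre_digraph \<Rightarrow> bool" where
  "regular G \<longleftrightarrow> (\<exists>d. \<forall>v\<in>pverts G. out_degree (with_proj G) v = d)"

end

theory Submission
  imports Defs
begin

text \<open>
  Let \<open>\<mu>\<close> be the maximum of the Rayleigh quotient of the Laplacian \<open>L\<close>. It is an eigenvalue of \<open>L\<close>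
  (lemma \<open>symmetric_top_eigenvalue\<close>), and since eigenvectors of a symmetric matrix for distinct
  eigenvalues are orthogonal, any spanning set of eigenvectors contains one for \<open>\<mu>\<close>, say \<open>b\<close>. Let
  \<open>s\<close> be the vector that is \<open>1\<close> on one colour class of the bipartite graph and \<open>-1\<close> on the other.
  As \<open>z = s \<bar>b\<bar>\<close> (entrywise) has opposite signs at the two ends of each edge, its quadratic form
  under \<open>L\<close> is at least that of \<open>b\<close> while its norm is the same. So \<open>z\<close> also maximises the Rayleigh
  quotient, and is therefore itself an eigenvector for \<open>\<mu>\<close> (lemmas \<open>Rayleigh_maximizer_eigen\<close> and
  \<open>signed_abs_top_eigenvector\<close>).

  This is the Perron--Frobenius argument: at a vertex where \<open>z\<close> vanishes, the eigenvector equation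
  says that a sum of terms of one sign is zero, so \<open>z\<close> vanishes at all neighbours, and by
  connectedness everywhere. Hence \<open>b\<close> has no zero entry. If its entries lie in \<open>{-1, 0, 1}\<close>, then
  \<open>\<bar>b\<bar> = 1\<close>, so \<open>z = s\<close>, and the eigenvector equation for \<open>s\<close> at a vertex \<open>v\<close> reads
  \<open>2 deg v = \<mu>\<close>.
\<close>

lemma symmetric_inner_swap:
  fixes A :: "real^'n^'n"
  assumes "transpose A = A"
  shows "x \<bullet> (A *v y) = (A *v x) \<bullet> y"
  by (metis assms dot_lmul_matrix vector_transpose_matrix)

text \<open>
  The nonnegative function \<open>\<mu> (y \<bullet> y) - y \<bullet> (A y)\<close> attains its minimum \<open>0\<close> at \<open>z\<close>, so its
  gradient \<open>2 (\<mu> z - A z)\<close> vanishes there.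
\<close>

lemma Rayleigh_maximizer_eigen:
  fixes A :: "real^'n^'n"
  assumes sym: "transpose A = A"
    and bound: "\<And>y. y \<bullet> (A *v y) \<le> \<mu> * (y \<bullet> y)"
    and max: "\<mu> * (z \<bullet> z) \<le> z \<bullet> (A *v z)"
  shows "A *v z = \<mu> *s z"
proof (rule ccontr)
  define w where "w = \<mu> *\<^sub>R z - A *v z"
  define c where "c = \<mu> * (w \<bullet> w) - w \<bullet> (A *v w)"
  assume "A *v z \<noteq> \<mu> *s z"
  then have w_pos: "0 < w \<bullet> w"
    by (simp add: w_def scalar_mult_eq_scaleR)
  have c: "0 \<le> c"
    using bound[of w] by (simp add: c_def)
  have eq: "z \<bullet> (A *v z) = \<mu> * (z \<bullet> z)"
    using bound[of z] max by simp
  have ww: "w \<bullet> w = \<mu> * (z \<bullet> w) - w \<bullet> (A *v z)"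
    by (subst (2) w_def) (simp add: inner_diff_right inner_commute)
  have expand: "0 \<le> 2 * t * (w \<bullet> w) + t\<^sup>2 * c" for t
  proof -
    have "z \<bullet> (A *v w) = w \<bullet> (A *v z)"
      using symmetric_inner_swap[OF sym, of z w] by (simp add: inner_commute)
    then have "\<mu> * ((z + t *\<^sub>R w) \<bullet> (z + t *\<^sub>R w)) - (z + t *\<^sub>R w) \<bullet> (A *v (z + t *\<^sub>R w))
        = 2 * t * (\<mu> * (z \<bullet> w) - w \<bullet> (A *v z)) + t\<^sup>2 * c"
      using eq unfolding c_def
      by (simp add: matrix_vector_right_distrib matrix_vector_mult_scaleR inner_add_left
          inner_add_right inner_commute[of w z] algebra_simps power2_eq_square)
    then show ?thesis
      using bound[of "z + t *\<^sub>R w"] by (simp only: ww)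
  qed
  define W where "W = w \<bullet> w"
  \<comment> \<open>A small step against the gradient makes the linear term win over the quadratic one.\<close>
  have "0 \<le> 2 * (- W / (c + 1)) * W + (- W / (c + 1))\<^sup>2 * c"
    using expand[of "- W / (c + 1)"] by (simp add: W_def)
  also have "\<dots> = - (W\<^sup>2 * (c + 2) / (c + 1)\<^sup>2)"
    using c by (simp add: divide_simps power2_eq_square) (simp add: algebra_simps)
  also have "\<dots> < 0"
    using c w_pos by (simp add: W_def)
  finally show False by simp
qed

text \<open>
  By compactness of the unit sphere the Rayleigh quotient has a maximum \<open>\<mu>\<close>, and a maximiser is an
  eigenvector.
\<close>

lemma symmetric_top_eigenvalue:
  fixes A :: "real^'n^'n"
  assumes sym: "transpose A = A"
  obtains \<mu> p where "p \<noteq> 0" "A *v p = \<mu> *s p" "\<And>y. y \<bullet> (A *v y) \<le> \<mu> * (y \<bullet> y)"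
proof -
  have "continuous_on (sphere 0 1) (\<lambda>y. y \<bullet> (A *v y))"
    by (intro continuous_intros)
  moreover have "sphere (0 :: real^'n) 1 \<noteq> {}"
    by simp
  ultimately obtain p where p: "norm p = 1"
    and max: "\<And>y. norm y = 1 \<Longrightarrow> y \<bullet> (A *v y) \<le> p \<bullet> (A *v p)"
    using continuous_attains_sup[OF compact_sphere[of "0 :: real^'n" 1]] by fastforce
  define \<mu> where "\<mu> = p \<bullet> (A *v p)"
  have bound: "y \<bullet> (A *v y) \<le> \<mu> * (y \<bullet> y)" for y
  proof (cases "y = 0")
    case False
    define u where "u = y /\<^sub>R norm y"
    have "norm u = 1"
      using False by (simp add: u_def)
    from False have "y \<bullet> (A *v y) = (norm y)\<^sup>2 * (u \<bullet> (A *v u))"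
      by (simp add: u_def matrix_vector_mult_scaleR power2_eq_square field_simps)
    also have "\<dots> \<le> (norm y)\<^sup>2 * \<mu>"
      using max[OF \<open>norm u = 1\<close>] by (simp add: \<mu>_def mult_left_mono)
    finally show ?thesis
      by (simp add: power2_norm_eq_inner mult.commute)
  qed simp
  have "p \<noteq> 0" "p \<bullet> p = 1"
    using p by (auto simp: norm_eq_1)
  then have "A *v p = \<mu> *s p"
    by (intro Rayleigh_maximizer_eigen[OF sym bound]) (simp add: \<mu>_def)
  with \<open>p \<noteq> 0\<close> show thesis
    using bound by (rule that)
qed

text \<open>
  If \<open>p\<close> is an eigenvector for \<open>\<mu>\<close>, then some \<open>b \<in> B\<close> is not orthogonal to \<open>p\<close>, and by symmetry of
  the matrix its eigenvalue can only be \<open>\<mu>\<close>.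
\<close>

lemma spanning_eigenvectors_hit_eigenvalue:
  fixes A :: "real^'n^'n"
  assumes sym: "transpose A = A"
    and span: "span B = UNIV"
    and eig: "\<And>x. x \<in> B \<Longrightarrow> eigenvector A x"
    and p: "p \<noteq> 0" "A *v p = \<mu> *s p"
  obtains b where "b \<in> B" "A *v b = \<mu> *s b"
proof -
  \<comment> \<open>A vector orthogonal to all of \<open>B\<close> is orthogonal to itself.\<close>
  have "\<exists>b\<in>B. p \<bullet> b \<noteq> 0"
  proof (rule ccontr)
    assume "\<not> (\<exists>b\<in>B. p \<bullet> b \<noteq> 0)"
    then have "orthogonal p x" if "x \<in> span B" for x
      using orthogonal_to_span[OF that, of p] by (auto simp: orthogonal_def)
    then show False
      using p span by (metis UNIV_I orthogonal_self)
  qed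
  then obtain b where b: "b \<in> B" "p \<bullet> b \<noteq> 0"
    by blast
  then obtain c where c: "A *v b = c *s b"
    using eig by (auto simp: eigenvector_def)
  have "c * (p \<bullet> b) = \<mu> * (p \<bullet> b)"
    using symmetric_inner_swap[OF sym, of p b] by (simp add: c p scalar_mult_eq_scaleR)
  then show thesis
    using that b c by simp
qed

lemma laplacian_vector_nth:
  "(laplacian_matrix G *v x) $ v
    = real (out_degree (with_proj G) v) * x $ v - (\<Sum>u | (v, u) \<in> parcs G. x $ u)"
proof -
  have "(degree_matrix G *v x) $ v = real (out_degree (with_proj G) v) * x $ v"
    by (simp add: degree_matrix_def matrix_vector_mult_def if_distrib[of "\<lambda>a. a * _"] cong: if_cong)
  moreover have "(adjacency_matrix G *v x) $ v = (\<Sum>u | (v, u) \<in> parcs G. x $ u)"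
    by (simp add: adjacency_matrix_def matrix_vector_mult_def sum.If_cases
        if_distrib[of "\<lambda>a. a * _"] cong: if_cong)
  ultimately show ?thesis
    by (simp add: laplacian_matrix_def matrix_vector_mult_diff_rdistrib)
qed

lemma out_degree_eq_card_neighbours:
  "out_degree (with_proj G) v = card {u. (v, u) \<in> parcs G}"
proof -
  have "out_arcs (with_proj G) v = Pair v ` {u. (v, u) \<in> parcs G}"
    by auto
  then show ?thesis
    by (simp add: out_degree_def card_image inj_on_def)
qed

lemma transpose_laplacian:
  fixes G :: "'v::finite pair_pre_digraph"
  assumes "sym (parcs G)"
  shows "transpose (laplacian_matrix G) = laplacian_matrix G"
  using assms
  by (auto simp: vec_eq_iff transpose_def laplacian_matrix_def degree_matrix_def
      adjacency_matrix_def dest: symD)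

text \<open>
  Replacing \<open>b\<close> by \<open>s \<bar>b\<bar>\<close> keeps the diagonal terms \<open>deg v * (b v)\<^sup>2\<close> of the quadratic form and turns
  each edge term \<open>- b v * b u\<close> into its absolute value.
\<close>

lemma signed_abs_top_eigenvector:
  fixes G :: "'v::finite pair_pre_digraph"
  assumes sym: "sym (parcs G)"
    and bound: "\<And>y. y \<bullet> (laplacian_matrix G *v y) \<le> \<mu> * (y \<bullet> y)"
    and b: "laplacian_matrix G *v b = \<mu> *s b"
    and s: "\<And>v. \<bar>s v\<bar> = 1" "\<And>u v. (u, v) \<in> parcs G \<Longrightarrow> s v = - s u"
  shows "laplacian_matrix G *v (\<chi> v. s v * \<bar>b $ v\<bar>) = \<mu> *s (\<chi> v. s v * \<bar>b $ v\<bar>)"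
proof (rule Rayleigh_maximizer_eigen[OF transpose_laplacian[OF sym] bound])
  define z where "z = (\<chi> v. s v * \<bar>b $ v\<bar>)"
  have ss: "s v * s v = 1" for v
    using s(1)[of v] by (metis abs_mult_self_eq mult_1)
  have sq: "z $ v * z $ v = b $ v * b $ v" for v
    using ss[of v] by (simp add: z_def mult.left_commute mult.assoc[symmetric])
  have edge: "z $ v * z $ u \<le> b $ v * b $ u" if "(v, u) \<in> parcs G" for v u
  proof -
    have "z $ v * z $ u = - (s v * s v * (\<bar>b $ v\<bar> * \<bar>b $ u\<bar>))"
      using s(2)[OF that] by (simp add: z_def)
    also have "\<dots> = - \<bar>b $ v * b $ u\<bar>"
      by (simp add: ss abs_mult)
    finally show ?thesis
      by linarith
  qed
  have form: "x \<bullet> (laplacian_matrix G *v x)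
      = (\<Sum>v\<in>UNIV. real (out_degree (with_proj G) v) * (x $ v * x $ v)
          - (\<Sum>u | (v, u) \<in> parcs G. x $ v * x $ u))" for x
    by (simp add: inner_vec_def laplacian_vector_nth right_diff_distrib sum_distrib_left
        mult.left_commute)
  have "\<mu> * (z \<bullet> z) = \<mu> * (b \<bullet> b)"
    by (simp add: inner_vec_def sq)
  also have "\<dots> = b \<bullet> (laplacian_matrix G *v b)"
    by (simp add: b scalar_mult_eq_scaleR)
  also have "\<dots> \<le> z \<bullet> (laplacian_matrix G *v z)"
    unfolding form sq by (intro sum_mono diff_left_mono) (use edge in auto)
  finally show "\<mu> * ((\<chi> v. s v * \<bar>b $ v\<bar>) \<bullet> (\<chi> v. s v * \<bar>b $ v\<bar>))
      \<le> (\<chi> v. s v * \<bar>b $ v\<bar>) \<bullet> (laplacian_matrix G *v (\<chi> v. s v * \<bar>b $ v\<bar>))"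
    by (simp add: z_def)
qed

lemma connected_adjacency_closed:
  assumes G: "pair_graph G" "Digraph_Component.connected (with_proj G)"
    and "u \<in> pverts G" "v \<in> pverts G" "P u"
    and step: "\<And>x y. (x, y) \<in> parcs G \<Longrightarrow> P x \<Longrightarrow> P y"
  shows "P v"
proof -
  interpret pair_graph G by fact
  have "strongly_connected (with_proj G)"
    using symmetric_connected_imp_strongly_connected sym_arcs G(2) by simp
  then have "u \<rightarrow>\<^sup>*\<^bsub>with_proj G\<^esub> v"
    using assms(3,4) by (auto simp: strongly_connected_def)
  then show ?thesis
    using \<open>P u\<close> by (induction rule: reachable_induct) (auto intro: step)
qed

theorem theorem5:
  fixes G :: "'v::finite pair_pre_digraph"
  assumes "pair_graph G"
    and "pverts G = UNIV"
    and "Digraph_Component.connected (with_proj G)"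
    and "bipartite G"
    and "sign_diagonalizable G"
  shows "regular G"
proof -
  interpret pair_graph G by fact
  have sym: "sym (parcs G)"
    using pair_sym_arcs by (simp add: symmetric_def)
  obtain U W where UW: "U \<inter> W = {}" "parcs G \<subseteq> U \<times> W \<union> W \<times> U"
    using assms(4) by (auto simp: bipartite_def)
  define s :: "'v \<Rightarrow> real" where "s v = (if v \<in> U then 1 else -1)" for v
  have s: "\<bar>s v\<bar> = 1" "(u, v) \<in> parcs G \<Longrightarrow> s v = - s u" for u v
    using UW by (auto simp: s_def)
  obtain B where B: "span B = UNIV" "\<And>x. x \<in> B \<Longrightarrow> eigenvector (laplacian_matrix G) x"
    "\<And>x v. x \<in> B \<Longrightarrow> x $ v \<in> {-1, 0, 1}"
    using assms(5) unfolding sign_diagonalizable_def by blast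
  obtain \<mu> p where p: "p \<noteq> 0" "laplacian_matrix G *v p = \<mu> *s p"
    and bound: "\<And>y. y \<bullet> (laplacian_matrix G *v y) \<le> \<mu> * (y \<bullet> y)"
    using symmetric_top_eigenvalue[OF transpose_laplacian[OF sym]] by blast
  obtain b where b: "b \<in> B" "laplacian_matrix G *v b = \<mu> *s b"
    using spanning_eigenvectors_hit_eigenvalue[OF transpose_laplacian[OF sym] B(1,2) p] by blast
  have "laplacian_matrix G *v (\<chi> v. s v * \<bar>b $ v\<bar>) = \<mu> *s (\<chi> v. s v * \<bar>b $ v\<bar>)"
    by (rule signed_abs_top_eigenvector[OF sym bound b(2) s])
  then have eig: "real (out_degree (with_proj G) v) * (s v * \<bar>b $ v\<bar>)
      - (\<Sum>u | (v, u) \<in> parcs G. s u * \<bar>b $ u\<bar>) = \<mu> * (s v * \<bar>b $ v\<bar>)" for v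
    using laplacian_vector_nth[of G "\<chi> v. s v * \<bar>b $ v\<bar>" v] by simp
  have nbr_sum: "(\<Sum>u | (v, u) \<in> parcs G. s u * \<bar>b $ u\<bar>)
      = - s v * (\<Sum>u | (v, u) \<in> parcs G. \<bar>b $ u\<bar>)" for v
    unfolding sum_distrib_left by (intro sum.cong) (auto simp: s(2))
  \<comment> \<open>At a zero of \<open>b\<close> only the neighbour sum is left in the eigenvector equation; its terms all
    have the sign of \<open>- s v\<close>.\<close>
  have zero_step: "b $ u = 0" if "(v, u) \<in> parcs G" "b $ v = 0" for v u
  proof -
    have "(\<Sum>u | (v, u) \<in> parcs G. \<bar>b $ u\<bar>) = 0"
      using eig[of v] s(1)[of v] that(2) by (auto simp: nbr_sum)
    then show ?thesis
      using that(1) by (simp add: sum_nonneg_eq_0_iff)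
  qed
  have "b $ v \<noteq> 0" for v
  proof
    assume "b $ v = 0"
    then have "b $ u = 0" for u
      using connected_adjacency_closed[OF assms(1,3), of v u "\<lambda>x. b $ x = 0"] zero_step
      by (simp add: assms(2))
    then show False
      using B(2)[OF b(1)] by (auto simp: eigenvector_def vec_eq_iff)
  qed
  then have abs_b: "\<bar>b $ v\<bar> = 1" for v
    using B(3)[OF b(1), of v] by auto
  have "2 * real (out_degree (with_proj G) v) = \<mu>" for v
  proof -
    have "s v * (2 * real (out_degree (with_proj G) v)) = s v * \<mu>"
      using eig[of v] unfolding nbr_sum by (simp add: abs_b out_degree_eq_card_neighbours algebra_simps)
    then show ?thesis
      using s(1)[of v] by auto
  qed
  then have "out_degree (with_proj G) v = out_degree (with_proj G) u" for u v
    by (metis mult_cancel_left of_nat_eq_iff zero_neq_numeral)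
  then show ?thesis
    by (auto simp: regular_def)
qed

end
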